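(* Let $(\mathcal X_n)$ be a sequence of Lyapunov stable $\mathcal O$-families converging to a quasi-controllable $\mathcal O$-family $\mathcal X$. Then $\mathcal X$ is also Lyapunov stable.
   Context: Fix a positive integer $N$ and a norm $\|\cdot\|$ on $\mathbb R^N$. Let $\mathcal T$ be either the half-axis $\{t\in\mathbb R: t\ge 0\}$ or the set of all nonnegative integers. Let $\mathcal X$ be a collection of functions $x:\mathcal T\to\mathbb R^N$. For $u\in\mathbb R^N$ and $s,t\in\mathcal T$, $s\le t$, put $\mathcal X(u,t,s)=\{x(t): x(\cdot)\in\mathcal X,\ x(s)=u\}$. $\mathcal X$ is called an $\mathcal O$-family if it satisfies: (1) sewing condition: for all $t_1\le t_2\le t_3$ in $\mathcal T$ and all $x,y\in\mathcal X$ with $x(t_2)=y(t_2)$ there is $z\in\mathcal X$ with $z(t)=x(t)$ for $t_1\le t\le t_2$ and $z(t)=y(t)$ for $t_2\le t\le t_3$; (2) homogeneity: $\mathcal X(\lambda u,t,0)=\lambda\mathcal X(u,t,0)$ for $u\in\mathbb R^N$, $t\in\mathcal T$, $\lambda\in\mathbb R$; (3) time invariance: $\mathcal X(u,t,s)=\mathcal X(u,t-s,0)$ for $u\in\mathbb R^N$, $s\le t$ in $\mathcal T$; (4) concavity: $\mathcal X(\lambda u+(1-\lambda)v,t,0)\subseteq\lambda\mathcal X(u,t,0)+(1-\lambda)\mathcal X(v,t,0)$ for $u,v\in\mathbb R^N$, $t\in\mathcal T$, $\lambda\in[0,1]$ (Minkowski sum); (5) local boundedness: there is a continuous function $\rho(t)$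 such that $\|x\|\le\rho(t)$ for all $x\in\mathcal X(u,t,0)$, $\|u\|=1$, $t\in\mathcal T$; (6) continuity: if $x_n\to x_0$ in $\mathbb R^N$, then $H(\mathcal X(x_n,t,0),\mathcal X(x_0,t,0))\to0$ for every $t\in\mathcal T$, where $H$ is the Hausdorff distance between sets in $\mathbb R^N$. A subspace $E\subseteq\mathbb R^N$ is invariant with respect to $\mathcal X$ if $\mathcal X(x,t,0)\subseteq E$ for all $x\in E$, $t\in\mathcal T$. An $\mathcal O$-family is quasi-controllable if there is no nonzero proper subspace of $\mathbb R^N$ invariant with respect to it. An $\mathcal O$-family $\mathcal X$ is Lyapunov stable if for some $\mu>0$, for all $x\in\mathbb R^N$, $\sup\{\|u\|: u\in\bigcup_{t\in\mathcal T}\mathcal X(x,t,0)\}\le\mu\|x\|$. $\mathcal O$-families $\mathcal X_n$ converge to the $\mathcal O$-family $\mathcal X$ if for all $x\in\mathbb R^N$ and $s\in\mathcal T$, $$\lim_{n\to\infty}\ \sup_{t\in\mathcal T,\ t\le s}H\bigl(\mathrm{cl}(\mathcal X_n(x,t,0)),\mathrm{cl}(\mathcal X(x,t,0))\bigr)=0,$$ where $\mathrm{cl}$ denotes closure. *)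

theory Defs
  imports "HOL-Analysis.Analysis"
begin

definition is_norm :: "(real^'n \<Rightarrow> real) \<Rightarrow> bool" where
  "is_norm nrm \<longleftrightarrow>
     (\<forall>x. 0 \<le> nrm x) \<and>
     (\<forall>x. nrm x = 0 \<longleftrightarrow> x = 0) \<and>
     (\<forall>c x. nrm (c *\<^sub>R x) = \<bar>c\<bar> * nrm x) \<and>
     (\<forall>x y. nrm (x + y) \<le> nrm x + nrm y)"

definition is_time_set :: "real set \<Rightarrow> bool" where
  "is_time_set T \<longleftrightarrow> T = {0..} \<or> T = \<nat>"

definition reach :: "(real \<Rightarrow> real^'n) set \<Rightarrow> real^'n \<Rightarrow> real \<Rightarrow> real \<Rightarrow> (real^'n) set" where
  "reach X u t s = {x t | x. x \<in> X \<and> x s = u}"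

text \<open>
  The Hausdorff distance takes values in \<open>[0, \<infinity>]\<close>; in particular the distance between the
  empty set and a nonempty set is \<open>\<infinity>\<close>, and the distance of the empty set to itself is 0.
\<close>

definition hausdorff_dist ::
    "(real^'n \<Rightarrow> real) \<Rightarrow> (real^'n) set \<Rightarrow> (real^'n) set \<Rightarrow> ennreal" where
  "hausdorff_dist nrm A B =
     max (SUP a\<in>A. INF b\<in>B. ennreal (nrm (a - b)))
         (SUP b\<in>B. INF a\<in>A. ennreal (nrm (a - b)))"

definition sewing :: "real set \<Rightarrow> (real \<Rightarrow> real^'n) set \<Rightarrow> bool" where
  "sewing T X \<longleftrightarrow>
     (\<forall>t1\<in>T. \<forall>t2\<in>T. \<forall>t3\<in>T. t1 \<le> t2 \<longrightarrow> t2 \<le> t3 \<longrightarrow>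
       (\<forall>x\<in>X. \<forall>y\<in>X. x t2 = y t2 \<longrightarrow>
         (\<exists>z\<in>X. (\<forall>t\<in>T. t1 \<le> t \<and> t \<le> t2 \<longrightarrow> z t = x t) \<and>
                (\<forall>t\<in>T. t2 \<le> t \<and> t \<le> t3 \<longrightarrow> z t = y t))))"

definition homogeneous :: "real set \<Rightarrow> (real \<Rightarrow> real^'n) set \<Rightarrow> bool" where
  "homogeneous T X \<longleftrightarrow>
     (\<forall>u. \<forall>t\<in>T. \<forall>c::real. reach X (c *\<^sub>R u) t 0 = (\<lambda>v. c *\<^sub>R v) ` reach X u t 0)"

definition time_invariant :: "real set \<Rightarrow> (real \<Rightarrow> real^'n) set \<Rightarrow> bool" where
  "time_invariant T X \<longleftrightarrow>
     (\<forall>u. \<forall>s\<in>T. \<forall>t\<in>T. s \<le> t \<longrightarrow> reach X u t s = reach X u (t - s) 0)"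

definition concave :: "real set \<Rightarrow> (real \<Rightarrow> real^'n) set \<Rightarrow> bool" where
  "concave T X \<longleftrightarrow>
     (\<forall>u v. \<forall>t\<in>T. \<forall>c\<in>{0..1::real}.
        reach X (c *\<^sub>R u + (1 - c) *\<^sub>R v) t 0
          \<subseteq> (\<lambda>w. c *\<^sub>R w) ` reach X u t 0 + (\<lambda>w. (1 - c) *\<^sub>R w) ` reach X v t 0)"

definition locally_bounded ::
    "(real^'n \<Rightarrow> real) \<Rightarrow> real set \<Rightarrow> (real \<Rightarrow> real^'n) set \<Rightarrow> bool" where
  "locally_bounded nrm T X \<longleftrightarrow>
     (\<exists>\<rho>::real \<Rightarrow> real. continuous_on T \<rho> \<and>
        (\<forall>t\<in>T. \<forall>u. nrm u = 1 \<longrightarrow> (\<forall>x\<in>reach X u t 0. nrm x \<le> \<rho> t)))"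

definition continuous_family ::
    "(real^'n \<Rightarrow> real) \<Rightarrow> real set \<Rightarrow> (real \<Rightarrow> real^'n) set \<Rightarrow> bool" where
  "continuous_family nrm T X \<longleftrightarrow>
     (\<forall>(\<xi> :: nat \<Rightarrow> real^'n) \<xi>0. \<xi> \<longlonglongrightarrow> \<xi>0 \<longrightarrow>
        (\<forall>t\<in>T. (\<lambda>n. hausdorff_dist nrm (reach X (\<xi> n) t 0) (reach X \<xi>0 t 0)) \<longlonglongrightarrow> 0))"

text \<open>
  Functions on the time set \<open>T\<close> are represented by total functions that are \<open>undefined\<close>
  outside \<open>T\<close>.
\<close>

definition O_family ::
    "(real^'n \<Rightarrow> real) \<Rightarrow> real set \<Rightarrow> (real \<Rightarrow> real^'n) set \<Rightarrow> bool" where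
  "O_family nrm T X \<longleftrightarrow>
     X \<subseteq> T \<rightarrow>\<^sub>E UNIV \<and>
     sewing T X \<and> homogeneous T X \<and> time_invariant T X \<and> concave T X \<and>
     locally_bounded nrm T X \<and> continuous_family nrm T X"

definition invariant_subspace ::
    "real set \<Rightarrow> (real \<Rightarrow> real^'n) set \<Rightarrow> (real^'n) set \<Rightarrow> bool" where
  "invariant_subspace T X E \<longleftrightarrow>
     subspace E \<and> (\<forall>x\<in>E. \<forall>t\<in>T. reach X x t 0 \<subseteq> E)"

definition quasi_controllable :: "real set \<Rightarrow> (real \<Rightarrow> real^'n) set \<Rightarrow> bool" where
  "quasi_controllable T X \<longleftrightarrow>
     \<not> (\<exists>E. invariant_subspace T X E \<and> E \<noteq> {0} \<and> E \<noteq> UNIV)"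

definition Lyapunov_stable ::
    "(real^'n \<Rightarrow> real) \<Rightarrow> real set \<Rightarrow> (real \<Rightarrow> real^'n) set \<Rightarrow> bool" where
  "Lyapunov_stable nrm T X \<longleftrightarrow>
     (\<exists>\<mu>::real. \<mu> > 0 \<and>
        (\<forall>x. (SUP u \<in> (\<Union>t\<in>T. reach X x t 0). ennreal (nrm u)) \<le> ennreal (\<mu> * nrm x)))"

definition family_converges ::
    "(real^'n \<Rightarrow> real) \<Rightarrow> real set \<Rightarrow> (nat \<Rightarrow> (real \<Rightarrow> real^'n) set) \<Rightarrow>
     (real \<Rightarrow> real^'n) set \<Rightarrow> bool" where
  "family_converges nrm T Xs X \<longleftrightarrow>
     (\<forall>x. \<forall>s\<in>T.
        (\<lambda>n. SUP t \<in> {t \<in> T. t \<le> s}.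
           hausdorff_dist nrm (closure (reach (Xs n) x t 0)) (closure (reach X x t 0)))
          \<longlonglongrightarrow> 0)"

end

theory Submission
  imports Defs
begin

text \<open>
  A Lyapunov stable \<open>\<O>\<close>-family \<open>Y\<close> carries a Lyapunov norm: the overshoot
  \<open>p x\<close>, the supremum of the norms of all points reachable from \<open>x\<close>. Homogeneity and concavity
  make \<open>p\<close> a norm, while sewing and time invariance make it non-increasing along \<open>Y\<close>.

  Let \<open>p\<^sub>n\<close> be the overshoot norm of the \<open>n\<close>-th family, and let \<open>q\<^sub>n\<close> be its multiple for which the
  values on the standard basis add up to 1. Then \<open>q\<^sub>n x \<le> norm x\<close>, with a constant that does not
  depend on \<open>n\<close>. This equicontinuity lets the monotonicity pass to the limit: if \<open>y\<close> is reachable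
  from \<open>x\<close> in the limit family, then \<open>q\<^sub>n y \<le> q\<^sub>n x + \<epsilon>\<close> for all large \<open>n\<close>
  (\<open>reach_limit_overshoot\<close>). Hence the vectors \<open>x\<close> with \<open>q\<^sub>n x \<longlonglongrightarrow> 0\<close> form an invariant subspace of
  the limit family. By the normalisation it is not the whole space, so quasi-controllability forces
  it to be zero.

  If the limit family were not stable, there would be reachable points \<open>y\<close> that are arbitrarily
  large compared with their starting points \<open>x\<close>. After scaling \<open>y\<close> to unit length, \<open>x\<close> is small, so
  that \<open>q\<^sub>n y\<close> is eventually small as well. An accumulation point of such unit vectors \<open>y\<close> would be
  a nonzero element of that zero subspace (\<open>bounded_gain_if_no_invariant_subspace\<close>).
\<close>

section \<open>Norms on a finite-dimensional space\<close>

lemma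
  assumes "is_norm p"
  shows is_norm_nonneg: "0 \<le> p x"
    and is_norm_zero_iff: "p x = 0 \<longleftrightarrow> x = 0"
    and is_norm_scale: "p (c *\<^sub>R x) = \<bar>c\<bar> * p x"
    and is_norm_triangle: "p (x + y) \<le> p x + p y"
  using assms unfolding is_norm_def by auto

lemma is_norm_minus_commute:
  assumes "is_norm p"
  shows "p (x - y) = p (y - x)"
  using is_norm_scale[OF assms, of "-1" "x - y"] by simp

lemma is_norm_divide:
  assumes "is_norm p" "0 < c"
  shows "is_norm (\<lambda>x. p x / c)"
  using assms unfolding is_norm_def by (auto simp: field_simps)

lemma is_norm_le_basis_sum:
  fixes p :: "real^'n \<Rightarrow> real"
  assumes p: "is_norm p"
  shows "p x \<le> (\<Sum>i\<in>Basis. p i) * norm x"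
proof -
  have sum_le: "p (sum f A) \<le> (\<Sum>i\<in>A. p (f i))" if "finite A" for f :: "real^'n \<Rightarrow> real^'n" and A
    using that
  proof (induction A rule: finite_induct)
    case empty
    show ?case using is_norm_zero_iff[OF p, of 0] by simp
  next
    case (insert a A)
    then show ?case using is_norm_triangle[OF p, of "f a" "sum f A"] by simp
  qed
  have "p x = p (\<Sum>i\<in>Basis. (x \<bullet> i) *\<^sub>R i)"
    by (simp add: euclidean_representation)
  also have "\<dots> \<le> (\<Sum>i\<in>Basis. p ((x \<bullet> i) *\<^sub>R i))"
    by (rule sum_le) simp
  also have "\<dots> \<le> (\<Sum>i\<in>Basis. norm x * p i)"
    by (intro sum_mono) (simp add: is_norm_scale[OF p] Basis_le_norm mult_right_mono is_norm_nonneg[OF p])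
  finally show ?thesis
    by (simp add: sum_distrib_left mult.commute)
qed

lemma basis_sum_pos:
  fixes p :: "real^'n \<Rightarrow> real"
  assumes p: "is_norm p"
  shows "0 < (\<Sum>i\<in>Basis. p i)"
proof (rule sum_pos)
  show "0 < p i" if "i \<in> Basis" for i
    using that is_norm_nonneg[OF p, of i] is_norm_zero_iff[OF p, of i] nonzero_Basis
    by (metis order_le_less)
qed simp_all

text \<open>Compactness of the unit sphere: the continuous function \<open>p\<close> attains a positive minimum there.\<close>

lemma norm_le_is_norm:
  fixes p :: "real^'n \<Rightarrow> real"
  assumes p: "is_norm p"
  obtains a where "0 < a" "\<And>x. norm x \<le> a * p x"
proof -
  let ?B = "\<Sum>i\<in>Basis. p i"
  have diff: "p x - p y \<le> ?B * norm (x - y)" for x y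
    using is_norm_triangle[OF p, of "x - y" y] is_norm_le_basis_sum[OF p, of "x - y"] by simp
  have "?B-lipschitz_on UNIV p"
  proof (rule lipschitz_onI)
    show "dist (p x) (p y) \<le> ?B * dist x y" for x y
      using diff[of x y] diff[of y x] by (simp add: dist_norm norm_minus_commute abs_le_iff)
  qed (use basis_sum_pos[OF p] in simp)
  then have cont: "continuous_on (sphere 0 1) p"
    using lipschitz_on_continuous_on continuous_on_subset by blast
  obtain e :: "real^'n" where "e \<in> Basis"
    using nonempty_Basis by blast
  then have "sphere (0 :: real^'n) 1 \<noteq> {}"
    using norm_Basis by force
  then obtain s where s: "s \<in> sphere 0 1" "\<And>x. x \<in> sphere 0 1 \<Longrightarrow> p s \<le> p x"
    using continuous_attains_inf[OF compact_sphere _ cont] by blast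
  have "s \<noteq> 0"
    using s(1) by auto
  then have pos: "0 < p s"
    using is_norm_nonneg[OF p, of s] is_norm_zero_iff[OF p, of s] by linarith
  have "norm x \<le> (1 / p s) * p x" for x
  proof (cases "x = 0")
    case False
    then have "p s \<le> p ((1 / norm x) *\<^sub>R x)"
      by (intro s(2)) simp
    then show ?thesis
      using False pos by (simp add: is_norm_scale[OF p] field_simps)
  qed (simp add: is_norm_nonneg[OF p] pos less_imp_le)
  with pos show ?thesis
    by (intro that[of "1 / p s"]) auto
qed

section \<open>Asymptotically monotone sequences of norms\<close>

text \<open>
  The relation \<open>R\<close> stands for reachability. The subspace of vectors on which the normalised norms
  \<open>q n\<close> tend to 0 is closed under \<open>R\<close>. Unbounded gain of \<open>R\<close> would put a unit vector into it, and
  the normalisation keeps it from being the whole space.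
\<close>

lemma bounded_gain_if_no_invariant_subspace:
  fixes q :: "nat \<Rightarrow> real^'n \<Rightarrow> real" and R :: "((real^'n) \<times> (real^'n)) set"
  assumes q: "\<And>n. is_norm (q n)"
    and normalised: "\<And>n. (\<Sum>i\<in>Basis. q n i) = 1"
    and mono: "\<And>x y \<epsilon>. (x, y) \<in> R \<Longrightarrow> 0 < \<epsilon> \<Longrightarrow> \<forall>\<^sub>F n in sequentially. q n y \<le> q n x + \<epsilon>"
    and no_inv: "\<And>E. subspace E \<Longrightarrow> (\<And>x y. (x, y) \<in> R \<Longrightarrow> x \<in> E \<Longrightarrow> y \<in> E) \<Longrightarrow> E = {0} \<or> E = UNIV"
  obtains C where "0 < C" "\<And>x y. (x, y) \<in> R \<Longrightarrow> norm y \<le> C * norm x"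
proof -
  define E where "E = {x. (\<lambda>n. q n x) \<longlonglongrightarrow> 0}"
  have in_E: "x \<in> E" if small: "\<And>\<epsilon>. 0 < \<epsilon> \<Longrightarrow> \<forall>\<^sub>F n in sequentially. q n x \<le> \<epsilon>" for x
  proof -
    have "\<forall>\<^sub>F n in sequentially. dist (q n x) 0 < \<epsilon>" if "0 < \<epsilon>" for \<epsilon>
      using small[of "\<epsilon> / 2"] that by (auto elim!: eventually_mono simp: is_norm_nonneg[OF q])
    then show ?thesis
      unfolding E_def by (auto intro: tendstoI)
  qed
  have le_norm: "q n x \<le> norm x" for n x
    using is_norm_le_basis_sum[OF q[of n], of x] normalised[of n] by simp
  have "subspace E"
  proof (rule subspaceI)
    show "0 \<in> E"
      by (simp add: E_def is_norm_zero_iff[OF q, THEN iffD2])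
    show "x + y \<in> E" if "x \<in> E" "y \<in> E" for x y
    proof -
      have "(\<lambda>n. q n x + q n y) \<longlonglongrightarrow> 0"
        using tendsto_add[of "\<lambda>n. q n x" 0 sequentially "\<lambda>n. q n y" 0] that by (simp add: E_def)
      then show ?thesis
        unfolding E_def mem_Collect_eq
        by (rule tendsto_sandwich[OF _ _ tendsto_const, rotated 2])
          (simp_all add: is_norm_nonneg[OF q] is_norm_triangle[OF q])
    qed
    show "c *\<^sub>R x \<in> E" if "x \<in> E" for c x
      using that by (auto simp: E_def is_norm_scale[OF q] intro: tendsto_mult_right_zero)
  qed
  moreover have "y \<in> E" if "(x, y) \<in> R" "x \<in> E" for x y
  proof (rule in_E)
    fix \<epsilon> :: real
    assume "0 < \<epsilon>"
    have "(\<lambda>n. q n x) \<longlonglongrightarrow> 0"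
      using that(2) by (simp add: E_def)
    then have "\<forall>\<^sub>F n in sequentially. q n x < \<epsilon> / 2"
      using \<open>0 < \<epsilon>\<close> by (intro order_tendstoD(2)) auto
    moreover have "\<forall>\<^sub>F n in sequentially. q n y \<le> q n x + \<epsilon> / 2"
      using mono[OF that(1)] \<open>0 < \<epsilon>\<close> by simp
    ultimately show "\<forall>\<^sub>F n in sequentially. q n y \<le> \<epsilon>"
      by eventually_elim simp
  qed
  moreover have "E \<noteq> UNIV"
  proof
    assume "E = UNIV"
    then have "(\<lambda>n. \<Sum>i\<in>Basis. q n i) \<longlonglongrightarrow> (\<Sum>i\<in>(Basis :: (real^'n) set). 0)"
      by (intro tendsto_sum) (auto simp: E_def set_eq_iff)
    then show False
      by (simp add: normalised LIMSEQ_const_iff)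
  qed
  ultimately have E: "E = {0}"
    using no_inv by blast

  have "\<exists>C>0. \<forall>x y. (x, y) \<in> R \<longrightarrow> norm y \<le> C * norm x"
  proof (rule ccontr)
    assume "\<not> ?thesis"
    then have "\<exists>x y. (x, y) \<in> R \<and> real (Suc k) * norm x < norm y" for k
      by (metis not_le of_nat_0_less_iff zero_less_Suc)
    then obtain x y where R: "\<And>k. (x k, y k) \<in> R" and gain: "\<And>k. real (Suc k) * norm (x k) < norm (y k)"
      by metis
    have y_pos: "0 < norm (y k)" for k
      by (rule le_less_trans[OF _ gain]) simp
    define z where "z k = (1 / norm (y k)) *\<^sub>R y k" for k
    have "z k \<in> sphere 0 1" for k
      using y_pos[of k] by (simp add: z_def)
    then obtain l r where l: "l \<in> sphere 0 1" and r: "strict_mono r" and lim: "(z \<circ> r) \<longlonglongrightarrow> l"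
      using compact_sphere[of "0 :: real^'n" 1] unfolding compact_def by metis
    have "l \<in> E"
    proof (rule in_E)
      fix \<epsilon> :: real
      assume "0 < \<epsilon>"
      have "\<forall>\<^sub>F k in sequentially. dist ((z \<circ> r) k) l < \<epsilon> / 3"
        using \<open>0 < \<epsilon>\<close> by (intro tendstoD[OF lim]) simp
      moreover have "\<forall>\<^sub>F k in sequentially. inverse (real (Suc k)) < \<epsilon> / 3"
        using \<open>0 < \<epsilon>\<close> by (intro order_tendstoD(2)[OF LIMSEQ_inverse_real_of_nat]) simp
      ultimately have "\<forall>\<^sub>F k in sequentially. dist ((z \<circ> r) k) l < \<epsilon> / 3 \<and> inverse (real (Suc k)) < \<epsilon> / 3"
        by (rule eventually_conj)
      then obtain k where near: "norm (l - z (r k)) < \<epsilon> / 3" and k: "inverse (real (Suc k)) < \<epsilon> / 3"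
        by (auto simp: dist_norm norm_minus_commute eventually_sequentially)
      \<comment> \<open>The index \<open>j\<close> is now fixed: \<open>y j\<close> is nearly parallel to \<open>l\<close> and \<open>x j\<close> is
        relatively small, so that only \<open>n\<close> has to grow.\<close>
      define j where "j = r k"
      have "k \<le> j"
        using seq_suble[OF r] by (simp add: j_def)
      then have "inverse (real (Suc j)) \<le> inverse (real (Suc k))"
        by (intro le_imp_inverse_le) auto
      then have j: "inverse (real (Suc j)) < \<epsilon> / 3"
        using k by (rule le_less_trans)
      have x_small: "norm (x j) \<le> \<epsilon> / 3 * norm (y j)"
      proof -
        have "norm (x j) \<le> inverse (real (Suc j)) * norm (y j)"
          using gain[of j] by (simp add: field_simps)
        also have "\<dots> \<le> \<epsilon> / 3 * norm (y j)"
          using j by (intro mult_right_mono) auto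
        finally show ?thesis .
      qed
      have "\<forall>\<^sub>F n in sequentially. q n (y j) \<le> q n (x j) + \<epsilon> / 3 * norm (y j)"
        using mono[OF R] \<open>0 < \<epsilon>\<close> y_pos[of j] by simp
      then show "\<forall>\<^sub>F n in sequentially. q n l \<le> \<epsilon>"
      proof eventually_elim
        case (elim n)
        have "q n (y j) \<le> \<epsilon> * (2 / 3) * norm (y j)"
          using elim x_small le_norm[of n "x j"] by simp
        then have "q n (z j) \<le> \<epsilon> * (2 / 3)"
          using y_pos[of j] by (simp add: z_def is_norm_scale[OF q] pos_divide_le_eq)
        moreover have "q n l \<le> q n (l - z j) + q n (z j)"
          using is_norm_triangle[OF q, of n "l - z j" "z j"] by simp
        ultimately show ?case
          using near le_norm[of n "l - z j"] by (simp add: j_def)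
      qed
    qed
    with E l show False
      by simp
  qed
  then show ?thesis
    using that by blast
qed

section \<open>The overshoot norm of a stable family\<close>

text \<open>
  Including \<open>x\<close> itself changes nothing for a nonempty \<open>\<O>\<close>-family and makes the overshoot of the empty
  family the original norm, so that the overshoot is a norm in either case.
\<close>

definition overshoot_set ::
    "real set \<Rightarrow> (real \<Rightarrow> real^'n) set \<Rightarrow> real^'n \<Rightarrow> (real^'n) set" where
  "overshoot_set T X x = insert x (\<Union>t\<in>T. reach X x t 0)"

definition overshoot ::
    "(real^'n \<Rightarrow> real) \<Rightarrow> real set \<Rightarrow> (real \<Rightarrow> real^'n) set \<Rightarrow> real^'n \<Rightarrow> real" where
  "overshoot nrm T X x = (SUP u\<in>overshoot_set T X x. nrm u)"

lemma time_set_zero: "is_time_set T \<Longrightarrow> 0 \<in> T"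
  and time_set_nonneg: "is_time_set T \<Longrightarrow> t \<in> T \<Longrightarrow> 0 \<le> t"
  and time_set_add: "is_time_set T \<Longrightarrow> s \<in> T \<Longrightarrow> t \<in> T \<Longrightarrow> s + t \<in> T"
  unfolding is_time_set_def by (auto elim: Nats_cases)

lemma Lyapunov_stableI:
  assumes "0 < \<mu>" "\<And>x t u. t \<in> T \<Longrightarrow> u \<in> reach X x t 0 \<Longrightarrow> nrm u \<le> \<mu> * nrm x"
  shows "Lyapunov_stable nrm T X"
  unfolding Lyapunov_stable_def
  using assms by (intro exI[of _ \<mu>]) (auto intro!: SUP_least ennreal_leI)

lemma Lyapunov_stableE:
  assumes "Lyapunov_stable nrm T X" "is_norm nrm"
  obtains \<mu> where "0 < \<mu>" "\<And>x t u. t \<in> T \<Longrightarrow> u \<in> reach X x t 0 \<Longrightarrow> nrm u \<le> \<mu> * nrm x"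
proof -
  obtain \<mu> where \<mu>: "0 < \<mu>"
    and le: "\<And>x. (SUP u \<in> (\<Union>t\<in>T. reach X x t 0). ennreal (nrm u)) \<le> ennreal (\<mu> * nrm x)"
    using assms(1) unfolding Lyapunov_stable_def by blast
  have "nrm u \<le> \<mu> * nrm x" if "t \<in> T" "u \<in> reach X x t 0" for x t u
  proof -
    have "ennreal (nrm u) \<le> ennreal (\<mu> * nrm x)"
      using that by (intro order.trans[OF SUP_upper le]) auto
    then show ?thesis
      using \<mu> is_norm_nonneg[OF assms(2), of x] by simp
  qed
  with \<mu> show ?thesis
    using that by blast
qed

text \<open>Concavity at the midpoint of \<open>2u\<close> and \<open>2v\<close>, freed of its coefficients by homogeneity.\<close>

lemma reach_add_subset:
  assumes "homogeneous T X" "concave T X" "t \<in> T" "w \<in> reach X (u + v) t 0"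
  obtains a b where "a \<in> reach X u t 0" "b \<in> reach X v t 0" "w = a + b"
proof -
  let ?half = "\<lambda>w :: real^'n. (1 / 2 :: real) *\<^sub>R w"
  have half: "?half ` reach X (2 *\<^sub>R v) t 0 = reach X v t 0" for v
    using assms(1,3) unfolding homogeneous_def by (simp add: image_image)
  have "reach X ((1 / 2) *\<^sub>R (2 *\<^sub>R u) + (1 - 1 / 2) *\<^sub>R (2 *\<^sub>R v)) t 0
      \<subseteq> ?half ` reach X (2 *\<^sub>R u) t 0 + (\<lambda>w. (1 - 1 / 2) *\<^sub>R w) ` reach X (2 *\<^sub>R v) t 0"
    using assms(2)[unfolded concave_def, rule_format, OF assms(3), of "1 / 2" "2 *\<^sub>R u" "2 *\<^sub>R v"] by simp
  then have "reach X (u + v) t 0 \<subseteq> reach X u t 0 + reach X v t 0"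
    by (simp add: half)
  then show ?thesis
    using assms(4) that by (auto elim!: set_plus_elim)
qed

lemma reach_trans:
  assumes T: "is_time_set T" and X: "sewing T X" "time_invariant T X"
    and "t \<in> T" "s \<in> T" and y: "y \<in> reach X x t 0" and z: "z \<in> reach X y s 0"
  shows "z \<in> reach X x (t + s) 0"
proof -
  have T': "0 \<in> T" "t + s \<in> T" "0 \<le> t" "0 \<le> s"
    using T \<open>t \<in> T\<close> \<open>s \<in> T\<close> time_set_zero time_set_add time_set_nonneg by auto
  then have "reach X y (t + s) t = reach X y s 0"
    using X(2) \<open>t \<in> T\<close> unfolding time_invariant_def by (metis add_diff_cancel_left' le_add_same_cancel1)
  with z have "z \<in> reach X y (t + s) t"
    by simp
  then obtain g where g: "g \<in> X" "g t = y" "g (t + s) = z"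
    by (auto simp: reach_def)
  obtain f where f: "f \<in> X" "f 0 = x" "f t = y"
    using y by (auto simp: reach_def)
  obtain h where h: "h \<in> X" "\<forall>\<tau>\<in>T. 0 \<le> \<tau> \<and> \<tau> \<le> t \<longrightarrow> h \<tau> = f \<tau>"
      "\<forall>\<tau>\<in>T. t \<le> \<tau> \<and> \<tau> \<le> t + s \<longrightarrow> h \<tau> = g \<tau>"
    using X(1)[unfolded sewing_def, rule_format, of 0 t "t + s" f g] T' \<open>t \<in> T\<close> f g by auto
  then have "h 0 = x" "h (t + s) = z"
    using T' f g by auto
  with h(1) show ?thesis
    by (auto simp: reach_def)
qed

lemma overshoot_set_bdd:
  assumes "is_norm nrm" "Lyapunov_stable nrm T X"
  shows "bdd_above (nrm ` overshoot_set T X x)"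
proof -
  obtain \<mu> where "0 < \<mu>" "\<And>x t u. t \<in> T \<Longrightarrow> u \<in> reach X x t 0 \<Longrightarrow> nrm u \<le> \<mu> * nrm x"
    using Lyapunov_stableE[OF assms(2,1)] by blast
  then show ?thesis
    unfolding overshoot_set_def
    by (intro bdd_aboveI2[of _ _ "max (nrm x) (\<mu> * nrm x)"]) (auto intro: max.coboundedI2)
qed

lemma overshoot_upper:
  assumes "is_norm nrm" "Lyapunov_stable nrm T X" "u \<in> overshoot_set T X x"
  shows "nrm u \<le> overshoot nrm T X x"
  unfolding overshoot_def using assms(3) overshoot_set_bdd[OF assms(1,2)] by (rule cSUP_upper)

lemma overshoot_least:
  assumes "\<And>u. u \<in> overshoot_set T X x \<Longrightarrow> nrm u \<le> c"
  shows "overshoot nrm T X x \<le> c"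
  unfolding overshoot_def using assms
  by (intro cSUP_least) (auto simp: overshoot_set_def)

lemma overshoot_set_add:
  assumes "homogeneous T X" "concave T X" "w \<in> overshoot_set T X (u + v)"
  obtains a b where "a \<in> overshoot_set T X u" "b \<in> overshoot_set T X v" "w = a + b"
proof (cases "w = u + v")
  case False
  then obtain t where t: "t \<in> T" "w \<in> reach X (u + v) t 0"
    using assms(3) by (auto simp: overshoot_set_def)
  with reach_add_subset[OF assms(1,2)] obtain a b where "a \<in> reach X u t 0" "b \<in> reach X v t 0" "w = a + b"
    by metis
  with t show ?thesis
    by (intro that[of a b]) (auto simp: overshoot_set_def)
qed (auto intro!: that simp: overshoot_set_def)

lemma overshoot_set_scale:
  assumes "homogeneous T X"
  shows "overshoot_set T X (c *\<^sub>R x) = (\<lambda>v. c *\<^sub>R v) ` overshoot_set T X x"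
proof -
  have "(\<Union>t\<in>T. reach X (c *\<^sub>R x) t 0) = (\<lambda>v. c *\<^sub>R v) ` (\<Union>t\<in>T. reach X x t 0)"
    using assms unfolding homogeneous_def by (auto simp: image_UN)
  then show ?thesis
    by (simp add: overshoot_set_def)
qed

lemma is_norm_overshoot:
  assumes nrm: "is_norm nrm" and stable: "Lyapunov_stable nrm T X"
    and X: "homogeneous T X" "concave T X"
  shows "is_norm (overshoot nrm T X)"
proof -
  note upper = overshoot_upper[OF nrm stable]
  have ge: "nrm x \<le> overshoot nrm T X x" for x
    by (rule upper) (simp add: overshoot_set_def)
  then have nonneg: "0 \<le> overshoot nrm T X x" for x
    using is_norm_nonneg[OF nrm] order.trans by blast
  have scale_le: "overshoot nrm T X (c *\<^sub>R x) \<le> \<bar>c\<bar> * overshoot nrm T X x" for c x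
    by (rule overshoot_least)
      (auto simp: overshoot_set_scale[OF X(1)] is_norm_scale[OF nrm] upper mult_left_mono)
  have scale: "overshoot nrm T X (c *\<^sub>R x) = \<bar>c\<bar> * overshoot nrm T X x" for c x
  proof (cases "c = 0")
    case True
    then show ?thesis
      using scale_le[of c x] nonneg[of "c *\<^sub>R x"] by simp
  next
    case False
    have "\<bar>c\<bar> * overshoot nrm T X x \<le> overshoot nrm T X (c *\<^sub>R x)"
      using scale_le[of "1 / c" "c *\<^sub>R x"] False by (simp add: field_simps)
    with scale_le[of c x] show ?thesis
      by (rule antisym)
  qed
  have "overshoot nrm T X (x + y) \<le> overshoot nrm T X x + overshoot nrm T X y" for x y
  proof (rule overshoot_least)
    fix w
    assume "w \<in> overshoot_set T X (x + y)"
    then obtain a b where "a \<in> overshoot_set T X x" "b \<in> overshoot_set T X y" "w = a + b"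
      using overshoot_set_add[OF X] by metis
    then show "nrm w \<le> overshoot nrm T X x + overshoot nrm T X y"
      using is_norm_triangle[OF nrm, of a b] upper[of a x] upper[of b y] by simp
  qed
  moreover have "overshoot nrm T X x = 0 \<longleftrightarrow> x = 0" for x
  proof
    assume "overshoot nrm T X x = 0"
    then show "x = 0"
      using ge[of x] is_norm_nonneg[OF nrm, of x] is_norm_zero_iff[OF nrm] by (metis antisym)
  next
    assume "x = 0"
    then show "overshoot nrm T X x = 0"
      using scale[of 0 x] by simp
  qed
  ultimately show ?thesis
    unfolding is_norm_def using nonneg scale by blast
qed

text \<open>Whatever is reachable from \<open>y\<close> is already reachable from \<open>x\<close>.\<close>

lemma overshoot_antimono_reach:
  assumes "is_time_set T" "is_norm nrm" "Lyapunov_stable nrm T X" "sewing T X" "time_invariant T X"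
    and "t \<in> T" "y \<in> reach X x t 0"
  shows "overshoot nrm T X y \<le> overshoot nrm T X x"
proof (rule overshoot_least)
  fix u
  assume "u \<in> overshoot_set T X y"
  then consider "u = y" | s where "s \<in> T" "u \<in> reach X y s 0"
    by (auto simp: overshoot_set_def)
  then have "u \<in> overshoot_set T X x"
  proof cases
    case 1
    then show ?thesis
      using assms(6,7) by (auto simp: overshoot_set_def)
  next
    case 2
    then have "u \<in> reach X x (t + s) 0" "t + s \<in> T"
      using reach_trans[OF assms(1,4,5,6) _ assms(7)] time_set_add[OF assms(1,6)] by auto
    then show ?thesis
      by (auto simp: overshoot_set_def)
  qed
  then show "nrm u \<le> overshoot nrm T X x"
    by (rule overshoot_upper[OF assms(2,3)])
qed

section \<open>Passage to the limit family\<close>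

lemma reach_approximation:
  fixes nrm :: "real^'n \<Rightarrow> real"
  assumes nrm: "is_norm nrm" and conv: "family_converges nrm T Xs X"
    and t: "t \<in> T" and y: "y \<in> reach X x t 0" and \<epsilon>: "0 < \<epsilon>"
  shows "\<forall>\<^sub>F n in sequentially. \<exists>v\<in>reach (Xs n) x t 0. norm (v - y) < \<epsilon>"
proof -
  obtain a where a: "0 < a" "\<And>x. norm x \<le> a * nrm x"
    using norm_le_is_norm[OF nrm] by blast
  let ?cl = "\<lambda>n \<tau>. closure (reach (Xs n) x \<tau> 0)"
  let ?H = "\<lambda>n \<tau>. hausdorff_dist nrm (?cl n \<tau>) (closure (reach X x \<tau> 0))"
  define \<delta> where "\<delta> = \<epsilon> / (2 * a)"
  have \<delta>: "0 < \<delta>" "a * \<delta> = \<epsilon> / 2"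
    using a(1) \<epsilon> by (simp_all add: \<delta>_def)
  have "(\<lambda>n. SUP \<tau> \<in> {\<tau> \<in> T. \<tau> \<le> t}. ?H n \<tau>) \<longlonglongrightarrow> 0"
    using conv t unfolding family_converges_def by blast
  then have "\<forall>\<^sub>F n in sequentially. (SUP \<tau> \<in> {\<tau> \<in> T. \<tau> \<le> t}. ?H n \<tau>) < ennreal \<delta>"
    using \<delta>(1) by (intro order_tendstoD(2)) auto
  then show ?thesis
  proof eventually_elim
    case (elim n)
    have "?H n t < ennreal \<delta>"
      using t by (intro le_less_trans[OF SUP_upper elim]) auto
    moreover have "(INF v\<in>?cl n t. ennreal (nrm (v - y))) \<le> ?H n t"
      unfolding hausdorff_dist_def using y closure_subset
      by (intro max.coboundedI2 SUP_upper) auto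
    ultimately have "(INF v\<in>?cl n t. ennreal (nrm (v - y))) < ennreal \<delta>"
      by (rule le_less_trans[rotated])
    then obtain v' where v': "v' \<in> ?cl n t" "nrm (v' - y) < \<delta>"
      by (auto simp: INF_less_iff ennreal_less_iff is_norm_nonneg[OF nrm])
    then obtain v where v: "v \<in> reach (Xs n) x t 0" "dist v v' < \<epsilon> / 2"
      using \<epsilon> closure_approachable[of v'] by (metis half_gt_zero)
    have "norm (v' - y) < \<epsilon> / 2"
      using le_less_trans[OF a(2)] mult_strict_left_mono[OF v'(2) a(1)] \<delta>(2) by metis
    then have "norm (v - y) < \<epsilon>"
      using v(2) norm_triangle_ineq[of "v - v'" "v' - y"] by (simp add: dist_norm)
    with v(1) show ?case
      by blast
  qed
qed

text \<open>
  The normalisation makes the norms \<open>q n\<close> equicontinuous, so that a point of the limit family may be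
  replaced by a nearby point reachable in the \<open>n\<close>-th family.
\<close>

lemma reach_limit_overshoot:
  fixes q :: "nat \<Rightarrow> real^'n \<Rightarrow> real"
  assumes nrm: "is_norm nrm" and conv: "family_converges nrm T Xs X"
    and q: "\<And>n. is_norm (q n)" and normalised: "\<And>n. (\<Sum>i\<in>Basis. q n i) = 1"
    and mono: "\<And>n v. v \<in> reach (Xs n) x t 0 \<Longrightarrow> q n v \<le> q n x"
    and t: "t \<in> T" and y: "y \<in> reach X x t 0" and \<epsilon>: "0 < \<epsilon>"
  shows "\<forall>\<^sub>F n in sequentially. q n y \<le> q n x + \<epsilon>"
  using reach_approximation[OF nrm conv t y \<epsilon>]
proof eventually_elim
  case (elim n)
  then obtain v where v: "v \<in> reach (Xs n) x t 0" "norm (v - y) < \<epsilon>"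
    by blast
  have "q n y \<le> q n (y - v) + q n v"
    using is_norm_triangle[OF q, of n "y - v" v] by simp
  moreover have "q n (y - v) \<le> norm (y - v)"
    using is_norm_le_basis_sum[OF q, of n "y - v"] normalised[of n] by simp
  ultimately show ?case
    using v(2) mono[OF v(1)] by (simp add: norm_minus_commute)
qed

theorem theorem4p3:
  fixes nrm :: "real^'n \<Rightarrow> real"
    and T :: "real set"
    and Xs :: "nat \<Rightarrow> (real \<Rightarrow> real^'n) set"
    and X :: "(real \<Rightarrow> real^'n) set"
  assumes "is_norm nrm"
    and "is_time_set T"
    and "\<And>n. O_family nrm T (Xs n)"
    and "\<And>n. Lyapunov_stable nrm T (Xs n)"
    and "O_family nrm T X"
    and "quasi_controllable T X"
    and "family_converges nrm T Xs X"
  shows "Lyapunov_stable nrm T X"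
proof -
  note nrm = assms(1) and T = assms(2) and stable = assms(4)
  have Xs: "homogeneous T (Xs n)" "concave T (Xs n)" "sewing T (Xs n)" "time_invariant T (Xs n)" for n
    using assms(3)[of n] by (auto simp: O_family_def)
  define p where "p n = overshoot nrm T (Xs n)" for n
  have p: "is_norm (p n)" for n
    unfolding p_def using is_norm_overshoot[OF nrm stable Xs(1,2)] .
  define S where "S n = (\<Sum>i\<in>Basis. p n i)" for n
  have S: "0 < S n" for n
    unfolding S_def using basis_sum_pos[OF p] .
  define q where "q n x = p n x / S n" for n x
  have q: "is_norm (q n)" for n
    unfolding q_def using is_norm_divide[OF p S] .
  have normalised: "(\<Sum>i\<in>Basis. q n i) = 1" for n
    using S[of n] by (simp add: q_def S_def flip: sum_divide_distrib)
  have mono: "q n v \<le> q n x" if "t \<in> T" "v \<in> reach (Xs n) x t 0" for n v x t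
    using overshoot_antimono_reach[OF T nrm stable Xs(3,4) that] S[of n]
    by (simp add: q_def p_def divide_right_mono)
  define R where "R = {(x, y). \<exists>t\<in>T. y \<in> reach X x t 0}"
  obtain C where C: "0 < C" "\<And>x y. (x, y) \<in> R \<Longrightarrow> norm y \<le> C * norm x"
  proof (rule bounded_gain_if_no_invariant_subspace[of q R, OF q normalised])
    show "\<forall>\<^sub>F n in sequentially. q n y \<le> q n x + \<epsilon>" if "(x, y) \<in> R" "0 < \<epsilon>" for x y \<epsilon>
      using that reach_limit_overshoot[OF nrm assms(7) q normalised mono] by (auto simp: R_def)
    show "E = {0} \<or> E = UNIV" if "subspace E" "\<And>x y. (x, y) \<in> R \<Longrightarrow> x \<in> E \<Longrightarrow> y \<in> E" for E
    proof -
      have "invariant_subspace T X E"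
        using that by (auto simp: invariant_subspace_def R_def)
      with assms(6) show ?thesis
        unfolding quasi_controllable_def by blast
    qed
  qed blast
  obtain a where a: "0 < a" "\<And>x. norm x \<le> a * nrm x"
    using norm_le_is_norm[OF nrm] by blast
  define B where "B = (\<Sum>i\<in>Basis. nrm i)"
  have B: "0 < B" "\<And>x. nrm x \<le> B * norm x"
    unfolding B_def using basis_sum_pos[OF nrm] is_norm_le_basis_sum[OF nrm] by auto
  show ?thesis
  proof (rule Lyapunov_stableI)
    show "0 < B * C * a"
      using a B C by simp
    show "nrm u \<le> B * C * a * nrm x" if "t \<in> T" "u \<in> reach X x t 0" for x t u
    proof -
      have "nrm u \<le> B * norm u"
        by (rule B)
      also have "\<dots> \<le> B * (C * norm x)"
        using that B C by (intro mult_left_mono) (auto simp: R_def)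
      also have "\<dots> \<le> B * (C * (a * nrm x))"
        using a B C by (intro mult_left_mono) auto
      finally show ?thesis
        by (simp add: mult.assoc)
    qed
  qed
qed

end
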